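(* Let $G=(V,E,\Sigma,\Pi)$ be a game (two-prover game) with $m=|E|$ edges, and let $\psi_\mathsf{s},\psi_\mathsf{t}\colon V\to\Sigma$ be two satisfying labelings of $G$. Then: (i) If the average degree of the underlying graph $(V,E)$ is at least $\frac{6}{\epsilon}$ for some $\epsilon\in(0,\frac14)$, then $\mathrm{val}_G(\psi_\mathsf{s}\leftrightsquigarrow\psi_\mathsf{t})\ge \frac14-\epsilon$. Moreover, the same conclusion holds even if $G$ is a general (i.e., not necessarily bipartite) constraint graph. (ii) If $G=(X,Y,E,\Sigma,\Pi)$ is balanced, i.e., $|X|=|Y|$, then $\mathrm{val}_G(\psi_\mathsf{s}\leftrightsquigarrow\psi_\mathsf{t})\ge \frac14\left(1-\frac{1}{\sqrt m}\right)$.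
   Context: A constraint graph is a tuple $G=(V,E,\Sigma,\Pi)$ where $(V,E)$ is a finite undirected graph (the underlying graph), $\Sigma$ is a finite alphabet, and $\Pi=(\pi_e)_{e\in E}$ with each $\pi_e\subseteq\Sigma^e$ a set of admissible pairs of values for the endpoints of $e$. If the underlying graph is bipartite with bipartition $(X,Y)$, $G$ is called a game and written $G=(X,Y,E,\Sigma,\Pi)$. A labeling is a map $\psi\colon V\to\Sigma$; it satisfies edge $e=(v,w)$ if $(\psi(v),\psi(w))\in\pi_e$, and satisfies $G$ if it satisfies every edge. $\mathrm{val}_G(\psi)$ is the fraction of edges of $E$ satisfied by $\psi$. A reconfiguration sequence from $\psi_\mathsf{s}$ to $\psi_\mathsf{t}$ is a sequence of labelings $\langle\psi^{(0)},\dots,\psi^{(\ell)}\rangle$ with $\psi^{(0)}=\psi_\mathsf{s}$, $\psi^{(\ell)}=\psi_\mathsf{t}$, and consecutive labelings differing in exactly one vertex; its value is $\min_i \mathrm{val}_G(\psi^{(i)})$. $\mathrm{val}_G(\psi_\mathsf{s}\leftrightsquigarrow\psi_\mathsf{t})$ denotes the maximum value over all reconfiguration sequences from $\psi_\mathsf{s}$ to $\psi_\mathsf{t}$. The average degree of $(V,E)$ is $2|E|/|V|$. *)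

theory Defs
  imports Complex_Main "HOL-Library.FuncSet"
begin

text \<open>
  Edges are two-element sets of vertices, so graphs have neither loops nor parallel edges.
  The constraint of an edge \<open>e\<close> is a set of functions in \<open>e \<rightarrow>\<^sub>E \<Sigma>\<close>; hence
  no orientation of \<open>e\<close> has to be chosen.
\<close>

record ('v, 'a) cgraph =
  verts :: "'v set"
  edges :: "'v set set"
  alphabet :: "'a set"
  constr :: "'v set \<Rightarrow> ('v \<Rightarrow> 'a) set"

definition constraint_graph :: "('v, 'a) cgraph \<Rightarrow> bool" where
  "constraint_graph G \<longleftrightarrow>
     finite (verts G) \<and> finite (alphabet G) \<and>
     (\<forall>e\<in>edges G. e \<subseteq> verts G \<and> card e = 2) \<and>
     (\<forall>e\<in>edges G. constr G e \<subseteq> e \<rightarrow>\<^sub>E alphabet G)"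

definition game :: "('v, 'a) cgraph \<Rightarrow> 'v set \<Rightarrow> 'v set \<Rightarrow> bool" where
  "game G X Y \<longleftrightarrow>
     constraint_graph G \<and> verts G = X \<union> Y \<and> X \<inter> Y = {} \<and>
     (\<forall>e\<in>edges G. \<exists>x\<in>X. \<exists>y\<in>Y. e = {x, y})"

definition average_degree :: "('v, 'a) cgraph \<Rightarrow> real" where
  "average_degree G = 2 * real (card (edges G)) / real (card (verts G))"

definition labelings :: "('v, 'a) cgraph \<Rightarrow> ('v \<Rightarrow> 'a) set" where
  "labelings G = verts G \<rightarrow>\<^sub>E alphabet G"

definition satisfies_edge :: "('v, 'a) cgraph \<Rightarrow> ('v \<Rightarrow> 'a) \<Rightarrow> 'v set \<Rightarrow> bool" where
  "satisfies_edge G \<psi> e \<longleftrightarrow> restrict \<psi> e \<in> constr G e"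

definition satisfies :: "('v, 'a) cgraph \<Rightarrow> ('v \<Rightarrow> 'a) \<Rightarrow> bool" where
  "satisfies G \<psi> \<longleftrightarrow> (\<forall>e\<in>edges G. satisfies_edge G \<psi> e)"

text \<open>
  A graph without edges has value 1, so that a labeling satisfies \<open>G\<close> iff its value is 1.
\<close>

definition val :: "('v, 'a) cgraph \<Rightarrow> ('v \<Rightarrow> 'a) \<Rightarrow> real" where
  "val G \<psi> =
     (if edges G = {} then 1
      else real (card {e \<in> edges G. satisfies_edge G \<psi> e}) / real (card (edges G)))"

definition differ_at_one :: "('v, 'a) cgraph \<Rightarrow> ('v \<Rightarrow> 'a) \<Rightarrow> ('v \<Rightarrow> 'a) \<Rightarrow> bool" where
  "differ_at_one G \<psi> \<psi>' \<longleftrightarrow> (\<exists>!v. v \<in> verts G \<and> \<psi> v \<noteq> \<psi>' v)"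

definition reconf_seq ::
  "('v, 'a) cgraph \<Rightarrow> ('v \<Rightarrow> 'a) \<Rightarrow> ('v \<Rightarrow> 'a) \<Rightarrow> ('v \<Rightarrow> 'a) list \<Rightarrow> bool" where
  "reconf_seq G \<psi>s \<psi>t \<psi>\<psi> \<longleftrightarrow>
     \<psi>\<psi> \<noteq> [] \<and> set \<psi>\<psi> \<subseteq> labelings G \<and> hd \<psi>\<psi> = \<psi>s \<and> last \<psi>\<psi> = \<psi>t \<and>
     successively (differ_at_one G) \<psi>\<psi>"

definition val_seq :: "('v, 'a) cgraph \<Rightarrow> ('v \<Rightarrow> 'a) list \<Rightarrow> real" where
  "val_seq G \<psi>\<psi> = Min (val G ` set \<psi>\<psi>)"

text \<open>
  For labelings of a constraint graph the set below is finite (edge fractions take finitely many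
  values) and nonempty (vertices can be relabeled one by one), so the maximum exists.
\<close>

definition val_reconf :: "('v, 'a) cgraph \<Rightarrow> ('v \<Rightarrow> 'a) \<Rightarrow> ('v \<Rightarrow> 'a) \<Rightarrow> real" where
  "val_reconf G \<psi>s \<psi>t = Max (val_seq G ` {\<psi>\<psi>. reconf_seq G \<psi>s \<psi>t \<psi>\<psi>})"

end

theory Submission imports Defs begin

text \<open>
  Relabel the vertices from \<open>\<psi>s\<close> to \<open>\<psi>t\<close> one by one. When \<open>U\<close> is the set of vertices already
  switched, every edge inside \<open>U\<close> or inside its complement is satisfied, so an order of the
  vertices is needed in which no initial segment cuts too many of the \<open>m\<close> edges.

  If the average degree is large, the number \<open>n\<close> of vertices, hence every degree, is at most a small
  multiple of \<open>m\<close>. Sort the vertices by degree and distribute consecutive pairs over two parts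
  \<open>A\<close>, \<open>B\<close>, choosing for each pair the orientation that cuts fewer edges. Both parts then
  contain \<open>m / 4 - O(n)\<close> edges; switch \<open>A\<close> first.

  For bipartite graphs, isolated vertices may pad the smaller side, so balance gives nothing
  and vertices of large degree (as in a star) must be handled: besides \<open>A\<close> and \<open>B\<close> there are
  two hubs, one on each side, that are switched between \<open>A\<close> and \<open>B\<close>. The hub \<open>x0\<close> is a vertex of
  maximum degree, placed at the median of its side with respect to degree; the hub \<open>y0\<close> is the
  median of the other side sorted by the proportion of edges going to the first half. One of
  the two orders of the hubs works, except for a matching with at most three edges.
\<close>

section \<open>Partial switchings\<close>

lemma finite_arg_max:
  fixes f :: "'b \<Rightarrow> real"
  assumes "finite S" "S \<noteq> {}"
  obtains x where "x \<in> S" "\<And>y. y \<in> S \<Longrightarrow> f y \<le> f x"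
proof -
  have "Max (f ` S) \<in> f ` S" using assms by simp
  then obtain x where "x \<in> S" "Max (f ` S) = f x" by blast
  moreover have "f y \<le> Max (f ` S)" if "y \<in> S" for y using assms(1) that by simp
  ultimately show thesis using that by metis
qed

locale simple_graph =
  fixes V :: "'v set" and E :: "'v set set"
  assumes finite_V: "finite V"
    and edge: "e \<in> E \<Longrightarrow> e \<subseteq> V \<and> card e = 2"
begin

lemma finite_E: "finite E"
  by (rule finite_subset[of _ "Pow V"]) (use edge finite_V in auto)

definition uncut :: "'v set \<Rightarrow> nat" where
  "uncut U = card {e \<in> E. e \<subseteq> U \<or> e \<inter> U = {}}"

definition inner :: "'v set \<Rightarrow> nat" where
  "inner S = card {e \<in> E. e \<subseteq> S}"

text \<open>The vertex \<open>v\<close> may already lie in \<open>U\<close>; such an idle step is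
  absorbed by reflexivity once switchings become relabelings.\<close>

definition switch_step :: "real \<Rightarrow> 'v set \<Rightarrow> 'v set \<Rightarrow> bool" where
  "switch_step k U U' \<longleftrightarrow>
     U \<subseteq> V \<and> (\<exists>v\<in>V. U' = insert v U) \<and> k \<le> real (uncut U) \<and> k \<le> real (uncut U')"

abbreviation switchable :: "real \<Rightarrow> 'v set \<Rightarrow> 'v set \<Rightarrow> bool" where
  "switchable k \<equiv> (switch_step k)\<^sup>*\<^sup>*"

text \<open>An edge inside both \<open>S\<close> and \<open>T\<close> would be empty, so nothing is
  counted twice. The bound does not depend on \<open>U\<close>, hence it covers a whole run of
  switches from \<open>S\<close> to the complement of \<open>T\<close>.\<close>

lemma uncut_ge:
  assumes "S \<subseteq> U" "T \<inter> U = {}"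
  shows "inner S + inner T \<le> uncut U"
proof -
  have "{e \<in> E. e \<subseteq> S} \<inter> {e \<in> E. e \<subseteq> T} = {}"
  proof (rule equals0I)
    fix e assume e: "e \<in> {e \<in> E. e \<subseteq> S} \<inter> {e \<in> E. e \<subseteq> T}"
    then have "e = {}" using assms by blast
    then show False using e edge[of e] by simp
  qed
  then have "inner S + inner T = card ({e \<in> E. e \<subseteq> S} \<union> {e \<in> E. e \<subseteq> T})"
    unfolding inner_def using finite_E by (subst card_Un_disjoint) auto
  also have "\<dots> \<le> uncut U"
    unfolding uncut_def by (rule card_mono) (use assms finite_E in auto)
  finally show ?thesis .
qed

lemma inner_ge_1: "e \<in> E \<Longrightarrow> e \<subseteq> S \<Longrightarrow> 1 \<le> inner S"
  unfolding inner_def using finite_E by (auto simp: Suc_le_eq card_gt_0_iff)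

lemma switchable_between:
  assumes "S \<subseteq> T" "T \<subseteq> V" "\<And>U. S \<subseteq> U \<Longrightarrow> U \<subseteq> T \<Longrightarrow> k \<le> real (uncut U)"
  shows "switchable k S T"
proof -
  have "switchable k S (S \<union> D)" if "D \<subseteq> T" for D
    using finite_subset[OF that finite_subset[OF assms(2) finite_V]] that
  proof (induction D rule: finite_induct)
    case empty
    then show ?case by simp
  next
    case (insert v D)
    have "switch_step k (S \<union> D) (S \<union> insert v D)"
      unfolding switch_step_def
      by (intro conjI assms(3) bexI[of _ v]) (use insert.prems assms(1,2) in auto)
    then show ?case using insert by (meson insert_subset rtranclp.rtrancl_into_rtrancl)
  qed
  from this[of T] assms(1) show ?thesis by (simp add: Un_absorb1)
qed

lemma switchable_two_parts:
  assumes "A \<union> B = V" "A \<inter> B = {}" "k \<le> real (inner A)" "k \<le> real (inner B)"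
  shows "switchable k {} V"
proof -
  have "switchable k {} A"
  proof (rule switchable_between)
    fix U assume "U \<subseteq> A"
    then show "k \<le> real (uncut U)" using uncut_ge[of "{}" U B] assms by fastforce
  qed (use assms in auto)
  also have "switchable k A V"
  proof (rule switchable_between)
    fix U assume "A \<subseteq> U"
    then show "k \<le> real (uncut U)" using uncut_ge[of A U "{}"] assms by fastforce
  qed (use assms in auto)
  finally show ?thesis .
qed

text \<open>The order is \<open>A\<close>, \<open>g\<close>, \<open>h\<close>, \<open>B\<close>.
  Before \<open>g\<close> moves, \<open>B\<close> and both hubs are untouched; once \<open>h\<close>
  has moved, \<open>A\<close> and both hubs are switched. The last bound serves the single set
  \<open>insert g A\<close> in between.\<close>

lemma switchable_two_hubs:
  assumes "A \<union> B \<union> {g, h} = V" "A \<inter> B = {}" "g \<notin> A \<union> B" "h \<notin> A \<union> B" "g \<noteq> h"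
    and "k \<le> real (inner (A \<union> {g, h}))" "k \<le> real (inner (B \<union> {g, h}))"
    and "k \<le> real (inner (insert g A)) + real (inner (insert h B))"
  shows "switchable k {} V"
proof -
  have A: "k \<le> real (uncut U)" if "U \<subseteq> A" for U
    using uncut_ge[of "{}" U "B \<union> {g, h}"] assms that by fastforce
  have B: "k \<le> real (uncut U)" if "A \<union> {g, h} \<subseteq> U" for U
    using uncut_ge[of "A \<union> {g, h}" U "{}"] assms that by fastforce
  have M: "k \<le> real (uncut (insert g A))"
    using uncut_ge[of "insert g A" "insert g A" "insert h B"] assms by fastforce
  have "switchable k {} A"
    by (rule switchable_between) (use A assms in auto)
  also have "switch_step k A (insert g A)"
    unfolding switch_step_def using A M assms by auto
  also have "switch_step k (insert g A) (A \<union> {g, h})"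
    unfolding switch_step_def using B[of "A \<union> {g, h}"] M assms by auto
  also have "switchable k (A \<union> {g, h}) V"
    by (rule switchable_between) (use B assms in auto)
  finally show ?thesis .
qed

section \<open>Counting edges by an adjacency matrix\<close>

definition adj :: "'v \<Rightarrow> 'v \<Rightarrow> real" where
  "adj u v = of_bool ({u, v} \<in> E)"

definition deg :: "'v \<Rightarrow> real" where
  "deg v = (\<Sum>u\<in>V. adj v u)"

lemma adj_commute: "adj u v = adj v u"
  by (simp add: adj_def insert_commute)

lemma adj_refl [simp]: "adj v v = 0"
  using edge[of "{v}"] by (auto simp: adj_def)

lemma adj_nonneg [simp]: "0 \<le> adj u v" and adj_le_1: "adj u v \<le> 1"
  by (auto simp: adj_def)

lemma adj_eq_sum: "adj u v = (\<Sum>e\<in>E. of_bool (e = {u, v}))"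
  using finite_E by (simp add: adj_def of_bool_def)

text \<open>Double counting of ordered pairs: for \<open>S = T\<close> every inner edge appears
  twice (\<open>handshake\<close>), for sets on opposite sides of a bipartition once
  (\<open>inner_bip\<close>).\<close>

lemma sum_adj_swap:
  "(\<Sum>u\<in>S. \<Sum>v\<in>T. adj u v) = (\<Sum>e\<in>E. real (card {(u, v) \<in> S \<times> T. e = {u, v}}))"
  if "finite S" "finite T"
proof -
  have "(\<Sum>u\<in>S. \<Sum>v\<in>T. adj u v) = (\<Sum>(u, v)\<in>S \<times> T. adj u v)"
    by (rule sum.cartesian_product)
  also have "\<dots> = (\<Sum>(u, v)\<in>S \<times> T. \<Sum>e\<in>E. of_bool (e = {u, v}))"
    by (simp only: adj_eq_sum)
  also have "\<dots> = (\<Sum>e\<in>E. \<Sum>(u, v)\<in>S \<times> T. of_bool (e = {u, v}))"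
    by (subst sum.swap) (simp add: case_prod_unfold)
  also have "\<dots> = (\<Sum>e\<in>E. real (card {(u, v) \<in> S \<times> T. e = {u, v}}))"
  proof (rule sum.cong)
    fix e
    have "{p \<in> S \<times> T. case p of (u, v) \<Rightarrow> e = {u, v}} = {(u, v) \<in> S \<times> T. e = {u, v}}"
      by auto
    then show "(\<Sum>(u, v)\<in>S \<times> T. of_bool (e = {u, v})) = real (card {(u, v) \<in> S \<times> T. e = {u, v}})"
      using that by (simp add: case_prod_unfold of_bool_def sum.If_cases Int_def)
  qed simp
  finally show ?thesis .
qed

lemma handshake:
  assumes "S \<subseteq> V"
  shows "(\<Sum>u\<in>S. \<Sum>v\<in>S. adj u v) = 2 * real (inner S)"
proof -
  have fin: "finite S" using assms finite_V finite_subset by blast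
  have "real (card {(u, v) \<in> S \<times> S. e = {u, v}}) = 2 * of_bool (e \<subseteq> S)" if "e \<in> E" for e
  proof -
    obtain a b where e: "e = {a, b}" "a \<noteq> b"
      using edge[OF \<open>e \<in> E\<close>] by (auto simp: card_2_iff)
    have "{(u, v) \<in> S \<times> S. e = {u, v}} = (if e \<subseteq> S then {(a, b), (b, a)} else {})"
      using e by (auto simp: doubleton_eq_iff)
    then show ?thesis using e by simp
  qed
  then have "(\<Sum>u\<in>S. \<Sum>v\<in>S. adj u v) = (\<Sum>e\<in>E. 2 * of_bool (e \<subseteq> S))"
    using sum_adj_swap[OF fin fin] by simp
  also have "\<dots> = 2 * real (inner S)"
    using finite_E by (simp add: inner_def sum_distrib_left[symmetric] of_bool_def sum.If_cases Int_def)
  finally show ?thesis .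
qed

lemma inner_V: "inner V = card E"
  unfolding inner_def by (rule arg_cong[of _ _ card]) (use edge in auto)

lemma deg_le: "deg v \<le> real (card V)"
proof -
  have "deg v \<le> (\<Sum>u\<in>V. 1)"
    unfolding deg_def by (intro sum_mono adj_le_1)
  then show ?thesis by simp
qed

lemma deg_nonneg: "0 \<le> deg v"
  by (simp add: deg_def sum_nonneg)

section \<open>Large average degree\<close>

text \<open>The signs encode a partition of \<open>S\<close>, and the quadratic form is twice the
  number of uncut minus cut edges within \<open>S\<close>. The induction varies \<open>M\<close>,
  because the vertices left after removing a pair are bounded by the smaller weight of that
  pair.\<close>

lemma exists_balanced_signs:
  assumes "finite S" "\<And>v. v \<in> S \<Longrightarrow> 0 \<le> d v \<and> d v \<le> (M::real)" "0 \<le> M"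
  shows "\<exists>\<sigma>. (\<forall>v. \<sigma> v \<in> {1, -1}) \<and> \<bar>\<Sum>v\<in>S. \<sigma> v * d v\<bar> \<le> M \<and>
           (\<Sum>u\<in>S. \<Sum>v\<in>S. \<sigma> u * \<sigma> v * adj u v) \<ge> - real (card S)"
  using assms
proof (induction "card S" arbitrary: S M rule: less_induct)
  case less
  consider "S = {}" | v where "S = {v}" | "card S \<ge> 2"
    by (metis One_nat_def Suc_leI card_0_eq card_1_singletonE less.prems(1) less_2_cases not_le)
  then show ?case
  proof cases
    case 1
    then show ?thesis using less.prems by (intro exI[of _ "\<lambda>_. 1"]) auto
  next
    case (2 v)
    then show ?thesis using less.prems by (intro exI[of _ "\<lambda>_. 1"]) auto
  next
    case 3
    txt \<open>Giving opposite signs to the two vertices of largest degree keeps the imbalance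
      bounded by the largest degree.\<close>
    have fin: "finite S" using less.prems by simp
    have "S \<noteq> {}" using 3 by auto
    then obtain u where u: "u \<in> S" "\<And>v. v \<in> S \<Longrightarrow> d v \<le> d u"
      using finite_arg_max[OF fin] by metis
    have "S - {u} \<noteq> {}" using 3 card_mono[of "{u}" S] by auto
    then obtain w where w: "w \<in> S - {u}" "\<And>v. v \<in> S - {u} \<Longrightarrow> d v \<le> d w"
      using finite_arg_max[of "S - {u}" d] fin by (metis finite_Diff)
    define R where "R = S - {u} - {w}"
    have R: "S = insert u (insert w R)" "u \<notin> insert w R" "w \<notin> R" "finite R"
      using u w fin by (auto simp: R_def)
    have "card R < card S" using R by simp
    then obtain \<sigma> where \<sigma>: "\<And>v. \<sigma> v \<in> {1, -1}" "\<bar>\<Sum>v\<in>R. \<sigma> v * d v\<bar> \<le> d w"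
        "(\<Sum>u\<in>R. \<Sum>v\<in>R. \<sigma> u * \<sigma> v * adj u v) \<ge> - real (card R)"
      using less.hyps[of R "d w"] less.prems w(1,2) R
      by (metis (no_types, lifting) Diff_iff R_def)
    \<comment> \<open>Apart from the edge between \<open>u\<close> and \<open>w\<close>, the pair
      contributes \<open>2 * (s * L)\<close> to the quadratic form; reversing its orientation
      negates this, so some sign makes it nonnegative.\<close>
    define L where "L = (\<Sum>v\<in>R. \<sigma> v * adj u v) - (\<Sum>v\<in>R. \<sigma> v * adj w v)"
    define s :: real where "s = (if L \<ge> 0 then 1 else -1)"
    have s: "s \<in> {1, -1}" "s * L \<ge> 0" "s * s = 1" by (auto simp: s_def)
    define \<tau> where "\<tau> = \<sigma>(u := s, w := -s)"
    have \<tau>: "\<tau> u = s" "\<tau> w = -s" "\<And>v. v \<in> R \<Longrightarrow> \<tau> v = \<sigma> v"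
      using R by (auto simp: \<tau>_def)
    have "(\<Sum>v\<in>S. \<tau> v * d v) = s * (d u - d w) + (\<Sum>v\<in>R. \<sigma> v * d v)"
      using R \<tau> by (simp add: algebra_simps cong: sum.cong)
    moreover have "\<bar>s * (d u - d w)\<bar> = d u - d w"
      using s u(2)[of w] w by (auto simp: abs_mult)
    ultimately have 1: "\<bar>\<Sum>v\<in>S. \<tau> v * d v\<bar> \<le> M"
      using \<sigma>(2) less.prems(2)[of u] u(1) by linarith
    have "(\<Sum>a\<in>S. \<Sum>b\<in>S. \<tau> a * \<tau> b * adj a b) =
        (\<Sum>a\<in>R. \<Sum>b\<in>R. \<sigma> a * \<sigma> b * adj a b) + 2 * (s * L) - 2 * adj u w"
    proof -
      have row: "(\<Sum>b\<in>S. \<tau> a * \<tau> b * adj a b) =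
          \<tau> a * (s * adj u a - s * adj w a + (\<Sum>b\<in>R. \<sigma> b * adj a b))" for a
        using R \<tau> adj_commute[of u a] adj_commute[of w a]
        by (simp add: algebra_simps sum_distrib_left cong: sum.cong)
      have "(\<Sum>a\<in>R. \<tau> a * (s * adj u a - s * adj w a + (\<Sum>b\<in>R. \<sigma> b * adj a b))) =
          s * L + (\<Sum>a\<in>R. \<Sum>b\<in>R. \<sigma> a * \<sigma> b * adj a b)"
        using \<tau>(3) by (simp add: L_def algebra_simps sum_distrib_left sum.distrib sum_subtractf
            cong: sum.cong)
      then show ?thesis
        unfolding row using R \<tau>(1,2) s(3) adj_commute[of w u]
        by (simp add: L_def algebra_simps)
    qed
    \<comment> \<open>The loss of at most 2 from a possible edge between \<open>u\<close> and
      \<open>w\<close> is paid for by the two vertices removed from \<open>S\<close>.\<close>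
    then have 2: "(\<Sum>a\<in>S. \<Sum>b\<in>S. \<tau> a * \<tau> b * adj a b) \<ge> - real (card S)"
      using \<sigma>(3) s(2) adj_le_1[of u w] R by simp
    have "\<forall>v. \<tau> v \<in> {1, -1}" using \<sigma>(1) s(1) by (auto simp: \<tau>_def)
    with 1 2 show ?thesis by blast
  qed
qed

text \<open>With m edges and n vertices, the quadratic form gives inner A + inner B >= m/2 - n/4,
  and the signed degree sum bounds the difference of the two by n/2. The smaller one is therefore at
  least m/4 - n/8 - n/4.\<close>

lemma exists_balanced_partition:
  obtains A B where "A \<union> B = V" "A \<inter> B = {}"
    "real (card E) / 4 - 3 / 8 * real (card V) \<le> real (inner A)"
    "real (card E) / 4 - 3 / 8 * real (card V) \<le> real (inner B)"
proof -
  have "0 \<le> deg v \<and> deg v \<le> real (card V)" for v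
    using deg_le deg_nonneg by blast
  then obtain \<sigma> where \<sigma>: "\<And>v. \<sigma> v \<in> {1, -1}" "\<bar>\<Sum>v\<in>V. \<sigma> v * deg v\<bar> \<le> real (card V)"
      "(\<Sum>u\<in>V. \<Sum>v\<in>V. \<sigma> u * \<sigma> v * adj u v) \<ge> - real (card V)"
    using exists_balanced_signs[OF finite_V, of deg "real (card V)"] by auto
  define A where "A = {v \<in> V. \<sigma> v = 1}"
  define B where "B = {v \<in> V. \<sigma> v = -1}"
  have AB: "A \<union> B = V" "A \<inter> B = {}" "A \<subseteq> V" "B \<subseteq> V" "finite A" "finite B"
    using \<sigma>(1) finite_V by (auto simp: A_def B_def)
  have split: "(\<Sum>v\<in>V. f v) = (\<Sum>v\<in>A. f v) + (\<Sum>v\<in>B. f v)" for f :: "'v \<Rightarrow> real"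
    using AB sum.union_disjoint by metis
  have A1: "\<And>v. v \<in> A \<Longrightarrow> \<sigma> v = 1" and B1: "\<And>v. v \<in> B \<Longrightarrow> \<sigma> v = -1"
    by (auto simp: A_def B_def)
  define c where "c = (\<Sum>u\<in>A. \<Sum>v\<in>B. adj u v)"
  have c': "(\<Sum>u\<in>B. \<Sum>v\<in>A. adj u v) = c"
    unfolding c_def by (subst sum.swap) (simp add: adj_commute)
  have tot: "2 * real (inner A) + 2 * real (inner B) + 2 * c = 2 * real (card E)"
    using handshake[of V] handshake[of A] handshake[of B] AB c' inner_V
    by (simp add: split sum.distrib c_def)
  \<comment> \<open>Each cut edge contributes one to the degree sum of either part, so
    \<open>c\<close> cancels.\<close>
  have "(\<Sum>v\<in>V. \<sigma> v * deg v) = 2 * real (inner A) - 2 * real (inner B)"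
    using handshake[of A] handshake[of B] AB c'
    by (simp add: split sum.distrib c_def deg_def A1 B1 sum_negf sum_subtractf)
  moreover have "(\<Sum>u\<in>V. \<Sum>v\<in>V. \<sigma> u * \<sigma> v * adj u v) = 2 * real (inner A) + 2 * real (inner B) - 2 * c"
    using handshake[of A] handshake[of B] AB c'
    by (simp add: split sum.distrib c_def A1 B1 sum_negf sum_subtractf)
  ultimately show thesis
    using \<sigma>(2,3) tot by (intro that[of A B] AB(1,2)) linarith+
qed

lemma deg_eq_card: "deg v = real (card {u \<in> V. {v, u} \<in> E})"
  using finite_V by (simp add: deg_def adj_def of_bool_def sum.If_cases Int_def)

end

section \<open>Bipartite graphs\<close>

text \<open>Take \<open>U\<close> maximal without \<open>h\<close> and of at most half the weight.
  If the rest \<open>W\<close> exceeded half, then \<open>U\<close> and \<open>h\<close> together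
  would weigh less than half; replacing \<open>h\<close> by a lighter \<open>x\<close> from
  \<open>W\<close> would enlarge \<open>U\<close>.\<close>

lemma median_split:
  fixes f :: "'b \<Rightarrow> real"
  assumes "finite X" "h \<in> X" "\<And>x. x \<in> X \<Longrightarrow> f x \<le> f h" "\<And>x. x \<in> X \<Longrightarrow> 0 \<le> f x"
  obtains X1 X2 where "X = insert h (X1 \<union> X2)" "h \<notin> X1 \<union> X2" "X1 \<inter> X2 = {}"
    "2 * sum f X1 \<le> sum f X" "2 * sum f X2 \<le> sum f X"
proof -
  define \<U> where "\<U> = {U. U \<subseteq> X - {h} \<and> 2 * sum f U \<le> sum f X}"
  have "finite \<U>" using assms(1) by (auto simp: \<U>_def intro: finite_subset[of _ "Pow X"])
  moreover have "{} \<in> \<U>" using assms by (auto simp: \<U>_def sum_nonneg)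
  ultimately obtain U where U: "U \<in> \<U>" "\<And>W. W \<in> \<U> \<Longrightarrow> U \<subseteq> W \<Longrightarrow> U = W"
    using finite_has_maximal[of \<U>] by blast
  define W where "W = X - {h} - U"
  have part: "X = insert h (U \<union> W)" "h \<notin> U \<union> W" "U \<inter> W = {}" and fin: "finite U" "finite W"
    using U(1) assms(1,2) by (auto simp: \<U>_def W_def intro: finite_subset)
  then have sum: "sum f X = f h + sum f U + sum f W"
    by (simp add: sum.union_disjoint)
  have "2 * sum f W \<le> sum f X"
  proof (rule ccontr)
    assume W: "\<not> 2 * sum f W \<le> sum f X"
    have "W \<noteq> {}" using W assms by (auto simp: sum_nonneg)
    then obtain x where x: "x \<in> W" by blast
    then have "x \<notin> U" "f x \<le> f h" using part assms(3) by auto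
    then have "insert x U \<in> \<U>"
      using U(1) W sum x fin part by (auto simp: \<U>_def)
    then show False using U(2) \<open>x \<notin> U\<close> by blast
  qed
  then show thesis using that part U(1) by (auto simp: \<U>_def)
qed

text \<open>Sort by the share of \<open>p\<close> in \<open>p + q\<close> and let \<open>U\<close>
  be a maximal top segment with at most half of \<open>p\<close>. As \<open>U\<close> is richest in
  \<open>p\<close>, it holds at most half of \<open>q\<close>. The next element \<open>h\<close>
  completes half of \<open>p\<close> on one side and is counted with the rest for \<open>q\<close>
  on the other.\<close>

lemma ratio_split:
  fixes p q :: "'b \<Rightarrow> real"
  assumes "finite Y" "Y \<noteq> {}" "\<And>y. y \<in> Y \<Longrightarrow> 0 \<le> p y" "\<And>y. y \<in> Y \<Longrightarrow> 0 \<le> q y"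
  obtains h Y1 Y2 where "Y = insert h (Y1 \<union> Y2)" "h \<notin> Y1 \<union> Y2" "Y1 \<inter> Y2 = {}"
    "sum p Y \<le> 2 * sum p (insert h Y1)" "sum q Y \<le> 2 * sum q (insert h Y2)"
proof (cases "sum p Y = 0")
  \<comment> \<open>Here the maximal segment would be all of \<open>Y\<close>, leaving no pivot, so
    an arbitrary \<open>h\<close> is taken.\<close>
  case True
  obtain h where h: "h \<in> Y" using assms(2) by blast
  then have "sum p Y \<le> 2 * sum p (insert h {})" "insert h (Y - {h}) = Y"
    using True assms(3) by auto
  then show thesis
    using that[of h "{}" "Y - {h}"] assms by (auto simp: sum_nonneg)
next
  case False
  then have P: "sum p Y > 0" using sum_nonneg[of Y p] assms(3) by fastforce
  txt \<open>A junk quotient \<open>0 / 0\<close> is harmless: \<open>cross\<close> is trivial when \<open>p\<close> and \<open>q\<close> both vanish.\<close>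
  define r where "r y = p y / (p y + q y)" for y
  have cross: "p y * q y' \<ge> p y' * q y" if "y \<in> Y" "y' \<in> Y" "r y' \<le> r y" for y y'
  proof (cases "p y + q y = 0 \<or> p y' + q y' = 0")
    case True
    then have "p y = 0 \<and> q y = 0 \<or> p y' = 0 \<and> q y' = 0"
      using assms(3,4) that(1,2) by (meson add_nonneg_eq_0_iff)
    then show ?thesis by auto
  next
    case False
    then have "p y + q y > 0" "p y' + q y' > 0"
      using assms(3,4) that(1,2) by (metis add_nonneg_nonneg order_le_less)+
    then show ?thesis using that(3) by (simp add: r_def field_simps)
  qed
  define \<U> where "\<U> = {U. U \<subseteq> Y \<and> (\<forall>y\<in>U. \<forall>y'\<in>Y - U. r y' \<le> r y) \<and> 2 * sum p U \<le> sum p Y}"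
  have "finite \<U>" using assms(1) by (auto simp: \<U>_def intro: finite_subset[of _ "Pow Y"])
  moreover have "{} \<in> \<U>" using P by (auto simp: \<U>_def)
  ultimately obtain U where U: "U \<in> \<U>" "\<And>W. W \<in> \<U> \<Longrightarrow> U \<subseteq> W \<Longrightarrow> U = W"
    using finite_has_maximal[of \<U>] by blast
  have UY: "U \<subseteq> Y" "finite U" and pU: "2 * sum p U \<le> sum p Y"
    and up: "\<And>y y'. y \<in> U \<Longrightarrow> y' \<in> Y - U \<Longrightarrow> r y' \<le> r y"
    using U(1) assms(1) by (auto simp: \<U>_def intro: finite_subset)
  have "Y - U \<noteq> {}" using pU P UY by auto
  then obtain h where h: "h \<in> Y - U" "\<And>y. y \<in> Y - U \<Longrightarrow> r y \<le> r h"
    using finite_arg_max[of "Y - U" r] assms(1) by (metis finite_Diff)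
  define W where "W = Y - U - {h}"
  have part: "Y = insert h (U \<union> W)" "h \<notin> U \<union> W" "U \<inter> W = {}" "insert h W = Y - U"
    using h UY by (auto simp: W_def)
  \<comment> \<open>\<open>insert h U\<close> is again a top segment, so it can only violate the
    weight bound.\<close>
  have "insert h U \<notin> \<U>" using U(2) h by blast
  then have p: "sum p Y \<le> 2 * sum p (insert h U)"
    using h up UY by (auto simp: \<U>_def not_le)
  have diff: "sum p (Y - U) = sum p Y - sum p U" "sum q (Y - U) = sum q Y - sum q U"
    using UY assms(1) by (simp_all add: sum_diff)
  \<comment> \<open>Sum \<open>cross\<close> over all pairs from \<open>U\<close> and
    \<open>Y - U\<close>; then the positive factor \<open>sum p (Y - U)\<close> cancels.\<close>
  have "sum p (Y - U) * sum q U \<le> sum p U * sum q (Y - U)"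
    unfolding sum_product
    by (subst sum.swap, intro sum_mono cross) (use UY up in auto)
  also have "\<dots> \<le> sum p (Y - U) * sum q (Y - U)"
    using pU diff assms(4) by (intro mult_right_mono sum_nonneg) auto
  finally have "sum q U \<le> sum q (Y - U)"
    using pU diff P by (simp add: mult_le_cancel_left)
  then have "sum q Y \<le> 2 * sum q (insert h W)"
    using diff part(4) by simp
  then show thesis using that[of h U W] part p by blast
qed

text \<open>Integrality of edge counts, for the small cases at the end of
  \<open>switchable_bip\<close>.\<close>

lemma real_add_less_1: "real i + real j < 1 \<Longrightarrow> real i = 0 \<and> real j = 0"
  by (simp flip: of_nat_add)

section \<open>Switching orders with two hubs in bipartite graphs\<close>

locale bipartite_graph = simple_graph V E for V :: "'v set" and E +
  fixes X Y :: "'v set"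
  assumes V_eq: "V = X \<union> Y" and disjoint: "X \<inter> Y = {}"
    and bip: "e \<in> E \<Longrightarrow> \<exists>x\<in>X. \<exists>y\<in>Y. e = {x, y}"
begin

lemma finite_XY: "finite X" "finite Y"
  using finite_V by (auto simp: V_eq)

lemma inner_bip:
  assumes "P \<subseteq> X" "Q \<subseteq> Y"
  shows "real (inner (P \<union> Q)) = (\<Sum>x\<in>P. \<Sum>y\<in>Q. adj x y)"
proof -
  have fin: "finite P" "finite Q" using assms finite_XY finite_subset by blast+
  have "real (card {(u, v) \<in> P \<times> Q. e = {u, v}}) = of_bool (e \<subseteq> P \<union> Q)" if eE: "e \<in> E" for e
  proof -
    obtain x y where e: "e = {x, y}" "x \<in> X" "y \<in> Y" using bip[OF eE] by blast
    have "{(u, v) \<in> P \<times> Q. e = {u, v}} = (if e \<subseteq> P \<union> Q then {(x, y)} else {})"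
      using e assms disjoint by (auto simp: doubleton_eq_iff)
    then show ?thesis by simp
  qed
  then have "(\<Sum>x\<in>P. \<Sum>y\<in>Q. adj x y) = (\<Sum>e\<in>E. of_bool (e \<subseteq> P \<union> Q))"
    using sum_adj_swap[OF fin] by simp
  also have "\<dots> = real (inner (P \<union> Q))"
    using finite_E by (simp add: inner_def of_bool_def sum.If_cases Int_def)
  finally show ?thesis by simp
qed

lemma adj_same_side: "x \<in> X \<Longrightarrow> x' \<in> X \<Longrightarrow> adj x x' = 0" "y \<in> Y \<Longrightarrow> y' \<in> Y \<Longrightarrow> adj y y' = 0"
proof -
  have "\<not> e \<subseteq> X \<and> \<not> e \<subseteq> Y" if "e \<in> E" for e
    using bip[OF that] disjoint by blast
  then show "x \<in> X \<Longrightarrow> x' \<in> X \<Longrightarrow> adj x x' = 0" "y \<in> Y \<Longrightarrow> y' \<in> Y \<Longrightarrow> adj y y' = 0"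
    unfolding adj_def by (metis empty_subsetI insert_subset of_bool_eq(1))+
qed

lemma deg_bip:
  "x \<in> X \<Longrightarrow> deg x = (\<Sum>y\<in>Y. adj x y)" "y \<in> Y \<Longrightarrow> deg y = (\<Sum>x\<in>X. adj x y)"
proof -
  show "deg x = (\<Sum>y\<in>Y. adj x y)" if "x \<in> X"
    unfolding deg_def using finite_XY disjoint that
    by (simp add: V_eq sum.union_disjoint adj_same_side)
  have "deg y = (\<Sum>x\<in>X. adj y x)" if "y \<in> Y"
    unfolding deg_def using finite_XY disjoint that
    by (simp add: V_eq sum.union_disjoint adj_same_side)
  then show "deg y = (\<Sum>x\<in>X. adj x y)" if "y \<in> Y"
    using that by (simp add: adj_commute)
qed

text \<open>\<open>{x, y}\<close> is an isolated edge, so every other edge lies in the complement;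
  the two parts are \<open>{x, y}\<close> and its complement.\<close>

lemma switchable_matching:
  assumes "x \<in> X" "y \<in> Y" "{x, y} \<in> E" "deg x \<le> 1" "deg y \<le> 1" "2 \<le> card E" "k \<le> 1"
  shows "switchable k {} V"
proof -
  have "\<exists>e\<in>E. e \<noteq> {x, y}"
    using assms(3,6) card_mono[of "{{x, y}}" E] by fastforce
  then obtain e where e: "e \<in> E" "e \<noteq> {x, y}" by blast
  have single: "u = u'" if "deg v \<le> 1" "{v, u} \<in> E" "{v, u'} \<in> E" for u u' v
  proof -
    have "{u, u'} \<subseteq> {u \<in> V. {v, u} \<in> E}" using that edge by auto
    then have "card {u, u'} \<le> card {u \<in> V. {v, u} \<in> E}"
      by (rule card_mono[rotated]) (simp add: finite_V)
    then show ?thesis using that(1) by (auto simp: deg_eq_card card_insert_if split: if_splits)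
  qed
  obtain a b where ab: "e = {a, b}" "a \<in> X" "b \<in> Y" using bip e by blast
  have "e \<inter> {x, y} = {}"
    using single[of x y b] single[of y x a] assms e ab disjoint by (auto simp: insert_commute)
  then have "e \<subseteq> V - {x, y}" using e edge by blast
  then have "1 \<le> inner (V - {x, y})" "1 \<le> inner {x, y}"
    using e(1) assms(3) inner_ge_1 by blast+
  then show ?thesis
    using assms V_eq by (intro switchable_two_parts[of "{x, y}" "V - {x, y}"]) auto
qed

text \<open>Halving first \<open>X\<close> and then \<open>Y\<close> secures a quarter of the edges
  at both ends of the order. Only the moment between the two hubs is critical, and if it fails for
  both orders of the hubs, few edges remain to be considered.\<close>

lemma switchable_bip:
  assumes "E \<noteq> {}" "x0 \<in> X" "\<And>v. v \<in> V \<Longrightarrow> deg v \<le> deg x0"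
  shows "switchable ((real (card E) - sqrt (real (card E))) / 4) {} V"
proof -
  define m where "m = real (card E)"
  define r where "r = sqrt m"
  define k where "k = (m - r) / 4"
  have "card E \<ge> 1" using assms(1) finite_E by (simp add: Suc_leI card_gt_0_iff)
  then have r: "r * r = m" "r \<ge> 1" by (auto simp: r_def m_def)
  obtain X1 X2 where X: "X = insert x0 (X1 \<union> X2)" "x0 \<notin> X1 \<union> X2" "X1 \<inter> X2 = {}"
    and mX: "2 * sum deg X1 \<le> sum deg X" "2 * sum deg X2 \<le> sum deg X"
    using median_split[OF finite_XY(1) assms(2), of deg] assms(3) V_eq deg_nonneg by blast
  define s where "s = (\<lambda>P Q. \<Sum>x\<in>P. \<Sum>y\<in>Q. adj x y)"
  have s_nonneg: "s P Q \<ge> 0" for P Q by (simp add: s_def sum_nonneg)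
  have "Y \<noteq> {}" using assms(1) bip by blast
  \<comment> \<open>The hub \<open>x0\<close> is counted in both weights, since it accompanies
    either half of \<open>X\<close>.\<close>
  then obtain y0 Y1 Y2 where Y: "Y = insert y0 (Y1 \<union> Y2)" "y0 \<notin> Y1 \<union> Y2" "Y1 \<inter> Y2 = {}"
    and mY: "(\<Sum>y\<in>Y. \<Sum>x\<in>insert x0 X1. adj x y) \<le> 2 * (\<Sum>y\<in>insert y0 Y1. \<Sum>x\<in>insert x0 X1. adj x y)"
      "(\<Sum>y\<in>Y. \<Sum>x\<in>insert x0 X2. adj x y) \<le> 2 * (\<Sum>y\<in>insert y0 Y2. \<Sum>x\<in>insert x0 X2. adj x y)"
    using ratio_split[OF finite_XY(2), of "\<lambda>y. \<Sum>x\<in>insert x0 X1. adj x y" "\<lambda>y. \<Sum>x\<in>insert x0 X2. adj x y"]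
    by (metis (no_types, lifting) adj_nonneg sum_nonneg)
  have mY': "s (insert x0 X1) Y \<le> 2 * s (insert x0 X1) (insert y0 Y1)"
    "s (insert x0 X2) Y \<le> 2 * s (insert x0 X2) (insert y0 Y2)"
    using mY unfolding s_def by (metis sum.swap)+
  have fin: "finite X1" "finite X2" "finite Y1" "finite Y2"
    using finite_XY X(1) Y(1) by auto
  have XY: "X1 \<subseteq> X" "X2 \<subseteq> X" "Y1 \<subseteq> Y" "Y2 \<subseteq> Y" "x0 \<in> X" "y0 \<in> Y" using X Y by auto
  have sX: "s (insert x0 P) Q = s {x0} Q + s P Q" if "P = X1 \<or> P = X2 \<or> P = X1 \<union> X2" for P Q
    using that X fin by (auto simp: s_def)
  have sY: "s P (insert y0 Q) = s P {y0} + s P Q" if "Q = Y1 \<or> Q = Y2 \<or> Q = Y1 \<union> Y2" for P Q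
    using that Y fin by (auto simp: s_def sum.distrib)
  have sX': "s (X1 \<union> X2) Q = s X1 Q + s X2 Q" for Q
    using X fin by (simp add: s_def sum.union_disjoint)
  have sY': "s P (Y1 \<union> Y2) = s P Y1 + s P Y2" for P
    using Y fin by (simp add: s_def sum.union_disjoint sum.distrib)
  have s_deg: "sum deg P = s P Y" if "P \<subseteq> X" for P
    using that deg_bip(1) by (auto simp: s_def intro!: sum.cong)
  have s_inner: "s P Q = real (inner (P \<union> Q))" if "P \<subseteq> X" "Q \<subseteq> Y" for P Q
    using inner_bip[OF that] by (simp add: s_def)
  have "m = s X Y" using s_inner[of X Y] inner_V V_eq by (simp add: m_def)
  \<comment> \<open>The edges split into blocks: \<open>a\<close> to \<open>d\<close> avoid both
    hubs, \<open>h1\<close> and \<open>h2\<close> meet only \<open>x0\<close>, \<open>k1\<close> and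
    \<open>k2\<close> meet only \<open>y0\<close>, and \<open>z\<close> is the possible edge between
    the hubs.\<close>
  define a b c d h1 h2 k1 k2 z where
    "a = s X1 Y1" and "b = s X1 Y2" and "c = s X2 Y1" and "d = s X2 Y2" and
    "h1 = s {x0} Y1" and "h2 = s {x0} Y2" and "k1 = s X1 {y0}" and "k2 = s X2 {y0}" and
    "z = s {x0} {y0}"
  note defs = this
  have total: "m = a + b + c + d + h1 + h2 + k1 + k2 + z"
    using \<open>m = s X Y\<close> by (simp add: defs X(1) Y(1) sX sY sX' sY')
  have x0: "deg x0 = h1 + h2 + z"
    using s_deg[of "{x0}"] XY by (simp add: defs Y(1) sY sY')
  have y0: "deg y0 = k1 + k2 + z"
    using deg_bip(2)[OF XY(6)] X(2,3) fin by (simp add: X(1) defs s_def sum.union_disjoint)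
  have "s X1 Y = a + b + k1" "s X2 Y = c + d + k2"
    by (simp_all add: defs Y(1) sY sY')
  then have volX: "2 * (a + b + k1) \<le> m" "2 * (c + d + k2) \<le> m"
    using mX XY by (simp_all add: s_deg \<open>m = s X Y\<close>)
  have volY: "a + b + k1 + h1 + h2 + z \<le> 2 * (a + h1 + k1 + z)"
    "c + d + k2 + h1 + h2 + z \<le> 2 * (d + h2 + k2 + z)"
    using mY' by (simp_all add: defs Y(1) sX sY sY')
  have nonneg: "a \<ge> 0" "d \<ge> 0" "h1 \<ge> 0" "h2 \<ge> 0" "k1 \<ge> 0" "k2 \<ge> 0" "z \<ge> 0"
    by (simp_all add: defs s_nonneg)
  have inner: "real (inner (X1 \<union> Y1 \<union> {x0, y0})) = a + h1 + k1 + z"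
    "real (inner (X2 \<union> Y2 \<union> {x0, y0})) = d + h2 + k2 + z"
    "real (inner (insert x0 (X1 \<union> Y1))) = a + h1" "real (inner (insert y0 (X1 \<union> Y1))) = a + k1"
    "real (inner (insert x0 (X2 \<union> Y2))) = d + h2" "real (inner (insert y0 (X2 \<union> Y2))) = d + k2"
    using s_inner[of "insert x0 X1" "insert y0 Y1"] s_inner[of "insert x0 X2" "insert y0 Y2"]
      s_inner[of "insert x0 X1" Y1] s_inner[of X1 "insert y0 Y1"]
      s_inner[of "insert x0 X2" Y2] s_inner[of X2 "insert y0 Y2"] XY
    by (simp_all add: defs sX sY insert_commute)
  \<comment> \<open>By \<open>volX\<close>, either half of \<open>X\<close> with \<open>x0\<close>
    meets at least m/2 edges; by \<open>volY\<close>, at least half of those end in the matching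
    half of \<open>Y\<close> with \<open>y0\<close>.\<close>
  have ends: "k \<le> real (inner (X1 \<union> Y1 \<union> {x0, y0}))" "k \<le> real (inner (X2 \<union> Y2 \<union> {x0, y0}))"
  proof -
    show "k \<le> real (inner (X1 \<union> Y1 \<union> {x0, y0}))"
      unfolding inner k_def using volX(2) volY(1) total r(2) by argo
    show "k \<le> real (inner (X2 \<union> Y2 \<union> {x0, y0}))"
      unfolding inner k_def using volX(1) volY(2) total r(2) by argo
  qed
  have V: "X1 \<union> Y1 \<union> (X2 \<union> Y2) \<union> {x0, y0} = V" "(X1 \<union> Y1) \<inter> (X2 \<union> Y2) = {}"
    "x0 \<notin> X1 \<union> Y1 \<union> (X2 \<union> Y2)" "y0 \<notin> X1 \<union> Y1 \<union> (X2 \<union> Y2)" "x0 \<noteq> y0"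
    using X Y V_eq disjoint by auto
  consider "k \<le> a + h1 + (d + k2)" | "k \<le> a + k1 + (d + h2)"
    | (small) "a + h1 + (d + k2) < k" "a + k1 + (d + h2) < k" by linarith
  then have "switchable k {} V"
  proof cases
    case 1
    then show ?thesis
      using switchable_two_hubs[OF V ends] inner by simp
  next
    case 2
    then show ?thesis
      using switchable_two_hubs[of "X1 \<union> Y1" "X2 \<union> Y2" y0 x0 k] V ends inner
      by (simp add: insert_commute)
  next
    case small
    \<comment> \<open>Adding both parts of \<open>small\<close> gives 2(a+d) + h1+h2+k1+k2 <
      (m-r)/2. Half the sum of \<open>volY\<close> gives a+d + h1+h2+k1+k2 + 2z >= (m + deg x0)/2.
      Together deg x0 + 2(a+d) + r < 4z, which excludes z = 0 and becomes \<open>key\<close> for z =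
      1.\<close>
    have "z = adj x0 y0" by (simp add: defs s_def)
    then have "z = 0 \<or> z = 1" by (simp add: adj_def)
    moreover have "z \<noteq> 0"
      using small volX volY total nonneg(1-6) r(2) unfolding k_def by argo
    ultimately have z: "z = 1" by simp
    then have x0y0: "{x0, y0} \<in> E" using \<open>z = adj x0 y0\<close> by (simp add: adj_def split: if_splits)
    have key: "deg x0 + 2 * (a + d) + r < 4"
      using small volX volY total x0 z unfolding k_def by argo
    have "deg x0 < 3" using key nonneg(1,2) r(2) by argo
    moreover have "deg x0 \<ge> 1" using x0 z nonneg(3,4) by argo
    ultimately consider "deg x0 = 1" | "deg x0 = 2"
      unfolding deg_eq_card by (cases "card {u \<in> V. {x0, u} \<in> E}" rule: nat.exhaust) force+
    then show ?thesis
    proof cases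
      case 1
      then have "deg y0 \<le> 1" using assms(3)[of y0] XY V_eq by auto
      then have 0: "h1 = 0" "h2 = 0" "k1 = 0" "k2 = 0"
        using 1 x0 y0 z nonneg(3-6) by argo+
      have "a + d < 1" using key r(2) 1 nonneg(1,2) by argo
      then have ad: "a = 0" "d = 0"
        using s_inner[OF XY(1,3)] s_inner[OF XY(2,4)] real_add_less_1 by (metis defs(1,4))+
      \<comment> \<open>Only \<open>b\<close>, \<open>c\<close> and \<open>z\<close> survive, and
        \<open>volY\<close> bounds \<open>b\<close> and \<open>c\<close> by \<open>z\<close>.
        Conversely \<open>small\<close> now says k > 0, which excludes a single edge.\<close>
      have "m \<le> 3" using volX volY total 0 ad z by argo
      then have "k \<le> 1" using r by (simp add: k_def)
      have "m > 1" using small 0 ad r(2) unfolding k_def by argo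
      then have "2 \<le> card E" by (simp add: m_def)
      show ?thesis
        by (rule switchable_matching[OF XY(5,6) x0y0 _ \<open>deg y0 \<le> 1\<close>])
          (use 1 \<open>k \<le> 1\<close> \<open>2 \<le> card E\<close> in auto)
    next
      case 2
      \<comment> \<open>This case is contradictory: fewer than four edges make k < 1, and then
        integrality forces h1 = h2 = 0, so \<open>x0\<close> has degree 1.\<close>
      have "r < 2" using key 2 nonneg(1,2) by argo
      then have "r * r < 4" using r mult_strict_mono[of r 2 r 2] by simp
      then have "k < 1" using r by (simp add: k_def)
      then have "a + h1 = 0" "d + k2 = 0" "a + k1 = 0" "d + h2 = 0"
        using small real_add_less_1 inner(3-6) by (metis less_trans)+
      then have "h1 + h2 + z = 1" using nonneg(1-6) z by argo
      then show ?thesis using 2 x0 by simp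
    qed
  qed
  then show ?thesis by (simp add: k_def r_def m_def)
qed

end

section \<open>From switchings to reconfiguration sequences\<close>

text \<open>The relation constrains only the source of each step, so the final labeling has its own
  hypotheses.\<close>

lemma val_reconf_ge:
  assumes "constraint_graph G"
    and "(\<lambda>\<psi> \<psi>'. \<psi> \<in> labelings G \<and> c \<le> val G \<psi> \<and> differ_at_one G \<psi> \<psi>')\<^sup>*\<^sup>* \<psi>s \<psi>t"
    and "\<psi>t \<in> labelings G" "c \<le> val G \<psi>t"
  shows "c \<le> val_reconf G \<psi>s \<psi>t"
proof -
  have "\<exists>\<psi>\<psi>. reconf_seq G \<psi>s \<psi>t \<psi>\<psi> \<and> (\<forall>\<psi>\<in>set \<psi>\<psi>. c \<le> val G \<psi>)"
    using assms(2)
  proof (induction rule: converse_rtranclp_induct)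
    case base
    show ?case using assms(3,4) by (intro exI[of _ "[\<psi>t]"]) (simp add: reconf_seq_def)
  next
    case (step \<psi> \<psi>')
    then obtain \<psi>\<psi> where "reconf_seq G \<psi>' \<psi>t \<psi>\<psi>" "\<forall>\<psi>\<in>set \<psi>\<psi>. c \<le> val G \<psi>" by blast
    with step(1) show ?case
      by (intro exI[of _ "\<psi> # \<psi>\<psi>"]) (auto simp: reconf_seq_def successively_Cons)
  qed
  then obtain \<psi>\<psi> where seq: "reconf_seq G \<psi>s \<psi>t \<psi>\<psi>" "\<forall>\<psi>\<in>set \<psi>\<psi>. c \<le> val G \<psi>" by blast
  interpret simple_graph "verts G" "edges G"
    using assms(1) by unfold_locales (auto simp: constraint_graph_def)
  \<comment> \<open>There may be infinitely many sequences, but their values lie in this finite set,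
    so \<open>Max\<close> is meaningful; the element 1 covers edgeless graphs.\<close>
  define R where "R = insert 1 ((\<lambda>k. real k / real (card (edges G))) ` {..card (edges G)})"
  have val: "val G \<psi> \<in> R" for \<psi>
    using card_mono[OF finite_E, of "{e \<in> edges G. satisfies_edge G \<psi> e}"]
    by (auto simp: val_def R_def)
  have "val_seq G \<psi>\<psi> \<in> R" if "reconf_seq G \<psi>s \<psi>t \<psi>\<psi>" for \<psi>\<psi>
  proof -
    have "val_seq G \<psi>\<psi> \<in> val G ` set \<psi>\<psi>"
      unfolding val_seq_def by (rule Min_in) (use that in \<open>auto simp: reconf_seq_def\<close>)
    then show ?thesis using val by auto
  qed
  then have "val_seq G ` {\<psi>\<psi>. reconf_seq G \<psi>s \<psi>t \<psi>\<psi>} \<subseteq> R" by blast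
  moreover have "finite R" by (simp add: R_def)
  ultimately have "finite (val_seq G ` {\<psi>\<psi>. reconf_seq G \<psi>s \<psi>t \<psi>\<psi>})"
    by (rule finite_subset)
  moreover have "c \<le> val_seq G \<psi>\<psi>"
    unfolding val_seq_def using seq by (subst Min_ge_iff) (auto simp: reconf_seq_def)
  ultimately show ?thesis
    unfolding val_reconf_def using seq(1) by (subst Max_ge_iff) auto
qed

text \<open>An uncut edge sees only one of the two satisfying labelings, so the mixed labeling
  satisfies it.\<close>

lemma val_reconf_ge_switchable:
  assumes G: "constraint_graph G"
    and s: "\<psi>s \<in> labelings G" "satisfies G \<psi>s" and t: "\<psi>t \<in> labelings G" "satisfies G \<psi>t"
    and sw: "simple_graph.switchable (verts G) (edges G) (c * real (card (edges G))) {} (verts G)"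
    and c: "c \<le> 1"
  shows "c \<le> val_reconf G \<psi>s \<psi>t"
proof -
  interpret simple_graph "verts G" "edges G"
    using G by unfold_locales (auto simp: constraint_graph_def)
  let ?m = "real (card (edges G))"
  define mix where "mix U = restrict (\<lambda>v. if v \<in> U then \<psi>t v else \<psi>s v) (verts G)" for U
  have mix_lab: "mix U \<in> labelings G" for U
    using s(1) t(1) by (auto simp: labelings_def mix_def)
  have val_mix: "c \<le> val G (mix U)" if U: "c * ?m \<le> real (uncut U)" for U
  proof (cases "edges G = {}")
    case True
    then show ?thesis using c by (simp add: val_def)
  next
    case False
    have "satisfies_edge G (mix U) e" if e: "e \<in> edges G" "e \<subseteq> U \<or> e \<inter> U = {}" for e
    proof -
      have "restrict (mix U) e = restrict \<psi>t e \<or> restrict (mix U) e = restrict \<psi>s e"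
        using e edge[OF e(1)] by (auto simp: mix_def restrict_def fun_eq_iff)
      then show ?thesis
        using s(2) t(2) e(1) by (auto simp: satisfies_def satisfies_edge_def)
    qed
    then have "uncut U \<le> card {e \<in> edges G. satisfies_edge G (mix U) e}"
      unfolding uncut_def by (intro card_mono) (use finite_E in auto)
    then have "c * ?m \<le> real (card {e \<in> edges G. satisfies_edge G (mix U) e})"
      using U by linarith
    moreover have "?m > 0" using False finite_E by (simp add: card_gt_0_iff)
    ultimately show ?thesis using False by (simp add: val_def pos_le_divide_eq)
  qed
  let ?R = "\<lambda>\<psi> \<psi>'. \<psi> \<in> labelings G \<and> c \<le> val G \<psi> \<and> differ_at_one G \<psi> \<psi>'"
  have switch: "?R\<^sup>*\<^sup>* (mix U) (mix U')" if st: "switch_step (c * ?m) U U'" for U U'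
  \<comment> \<open>Both labelings agree if \<open>v\<close> was already switched or has the same
    value under \<psi>s and \<psi>t; then the empty path is used, as \<open>differ_at_one\<close>
    demands a change.\<close>
  proof (cases "mix U = mix U'")
    case False
    obtain v where v: "v \<in> verts G" "U' = insert v U"
      using st by (auto simp: switch_step_def)
    have eq: "mix U u = mix U' u" if "u \<noteq> v" for u
      using v that by (simp add: mix_def restrict_def)
    then have "mix U v \<noteq> mix U' v" using False by (metis ext)
    then have "differ_at_one G (mix U) (mix U')"
      unfolding differ_at_one_def using eq v(1) by metis
    moreover have "c \<le> val G (mix U)"
      using st val_mix by (auto simp: switch_step_def)
    ultimately show ?thesis using mix_lab by auto
  qed simp
  have "?R\<^sup>*\<^sup>* (mix {}) (mix (verts G))"
    using sw
  proof (induction rule: rtranclp_induct)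
    case (step U U')
    then show ?case
      using switch[of U U']
      by (meson rtranclp_trans)
  qed simp
  moreover have "mix {} = \<psi>s" "mix (verts G) = \<psi>t"
    using s(1) t(1) by (auto simp: mix_def labelings_def restrict_def fun_eq_iff PiE_def extensional_def)
  moreover have "val G \<psi>t = 1"
  proof -
    have "{e \<in> edges G. satisfies_edge G \<psi>t e} = edges G" using t(2) by (auto simp: satisfies_def)
    then show ?thesis using finite_E by (simp add: val_def)
  qed
  ultimately show ?thesis
    using val_reconf_ge[OF G, of c \<psi>s \<psi>t] t(1) c by simp
qed

lemma val_reconf_ge_average_degree:
  assumes "constraint_graph G"
    and "\<psi>s \<in> labelings G" "satisfies G \<psi>s" "\<psi>t \<in> labelings G" "satisfies G \<psi>t"
    and "0 < \<epsilon>" "average_degree G \<ge> 6 / \<epsilon>"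
  shows "val_reconf G \<psi>s \<psi>t \<ge> 1/4 - \<epsilon>"
proof -
  interpret simple_graph "verts G" "edges G"
    using assms(1) by unfold_locales (auto simp: constraint_graph_def)
  define m where "m = real (card (edges G))"
  define n where "n = real (card (verts G))"
  \<comment> \<open>A graph without vertices has average degree 0 by the convention for division by
    zero, so positivity yields n > 0 as well as m > 0.\<close>
  have "6 / \<epsilon> > 0" using assms(6) by simp
  then have "2 * m / n > 0" using assms(7) unfolding average_degree_def m_def n_def by linarith
  then have mn: "m > 0" "n > 0"
    by (auto simp: m_def n_def zero_less_divide_iff zero_less_mult_iff)
  have "6 * n \<le> 2 * m * \<epsilon>"
    using assms(6,7) mn by (simp add: average_degree_def field_simps m_def n_def)
  then have n: "3 * n \<le> \<epsilon> * m" by (simp add: mult.commute)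
  obtain A B where AB: "A \<union> B = verts G" "A \<inter> B = {}"
    "m / 4 - 3 / 8 * n \<le> real (inner A)" "m / 4 - 3 / 8 * n \<le> real (inner B)"
    unfolding m_def n_def by (rule exists_balanced_partition)
  have "(1/4 - \<epsilon>) * m \<le> m / 4 - 3 / 8 * n"
    using n mn by (simp add: algebra_simps)
  then have "switchable ((1/4 - \<epsilon>) * m) {} (verts G)"
    using AB by (intro switchable_two_parts[of A B]) auto
  then show ?thesis
    unfolding m_def using assms(1-6) by (intro val_reconf_ge_switchable) auto
qed

lemma val_reconf_ge_game:
  assumes "game G X Y"
    and "\<psi>s \<in> labelings G" "satisfies G \<psi>s" "\<psi>t \<in> labelings G" "satisfies G \<psi>t"
  shows "val_reconf G \<psi>s \<psi>t \<ge> 1/4 * (1 - 1 / sqrt (real (card (edges G))))"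
proof -
  define m where "m = real (card (edges G))"
  have G: "constraint_graph G" using assms(1) by (simp add: game_def)
  interpret bipartite_graph "verts G" "edges G" X Y
    using assms(1) by unfold_locales (auto simp: constraint_graph_def game_def)
  \<comment> \<open>A vertex of maximum degree may lie on either side.\<close>
  interpret flip: bipartite_graph "verts G" "edges G" Y X
  proof
    show "verts G = Y \<union> X" "Y \<inter> X = {}" using V_eq disjoint by auto
    show "\<exists>y\<in>Y. \<exists>x\<in>X. e = {y, x}" if "e \<in> edges G" for e
      using bip[OF that] by (metis insert_commute)
  qed
  have sw: "switchable ((m - sqrt m) / 4) {} (verts G)"
  proof (cases "edges G = {}")
    case True
    then show ?thesis by (intro switchable_between) (auto simp: m_def)
  next
    case False
    then have "verts G \<noteq> {}" using edge by fastforce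
    then obtain v where v: "v \<in> verts G" "\<And>u. u \<in> verts G \<Longrightarrow> deg u \<le> deg v"
      using finite_arg_max[OF finite_V, of deg] by metis
    then consider "v \<in> X" | "v \<in> Y" using V_eq by blast
    then show ?thesis
      unfolding m_def using switchable_bip[OF False _ v(2)] flip.switchable_bip[OF False _ v(2)]
      by cases blast+
  qed
  moreover have "(m - sqrt m) / 4 = 1/4 * (1 - 1 / sqrt m) * m"
  proof -
    \<comment> \<open>This includes m = 0, where both sides are 0.\<close>
    have "m / sqrt m = sqrt m" by (simp add: m_def real_div_sqrt)
    then show ?thesis by (simp add: algebra_simps)
  qed
  ultimately have "switchable (1/4 * (1 - 1 / sqrt m) * m) {} (verts G)" by simp
  moreover have "1/4 * (1 - 1 / sqrt m) \<le> 1"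
  proof -
    have "0 \<le> 1 / sqrt m" by (simp add: m_def)
    then show ?thesis by argo
  qed
  ultimately show ?thesis
    using val_reconf_ge_switchable[OF G assms(2-5)] by (simp only: m_def)
qed

theorem theorem1:
  fixes G :: "('v, 'a) cgraph" and \<psi>s \<psi>t :: "'v \<Rightarrow> 'a"
  assumes "constraint_graph G"
    and "\<psi>s \<in> labelings G" and "satisfies G \<psi>s"
    and "\<psi>t \<in> labelings G" and "satisfies G \<psi>t"
  shows
    "(\<forall>X Y. game G X Y \<longrightarrow>
        (\<forall>\<epsilon>::real. 0 < \<epsilon> \<and> \<epsilon> < 1/4 \<and> average_degree G \<ge> 6 / \<epsilon> \<longrightarrow>
           val_reconf G \<psi>s \<psi>t \<ge> 1/4 - \<epsilon>)) \<and>
     (\<forall>\<epsilon>::real. 0 < \<epsilon> \<and> \<epsilon> < 1/4 \<and> average_degree G \<ge> 6 / \<epsilon> \<longrightarrow>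
        val_reconf G \<psi>s \<psi>t \<ge> 1/4 - \<epsilon>) \<and>
     (\<forall>X Y. game G X Y \<and> card X = card Y \<longrightarrow>
        val_reconf G \<psi>s \<psi>t \<ge> 1/4 * (1 - 1 / sqrt (real (card (edges G)))))"
  using val_reconf_ge_average_degree[OF assms(1-5)] val_reconf_ge_game[OF _ assms(2-5)] by blast

end
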